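(* Assume that $\mathbf{p}\in\,]0,1[^n$ is nondegenerate and consider a set function $i\colon 2^N\to\mathbb{R}$. There exists a unique function $f\in\mathcal{F}^N$ such that $\Phi_{\mathrm{B},\mathbf{p}}(f,S)=i(S)$ for every nonempty $S\subseteq N$ and $I_{\mathrm{B},\mathbf{p}}(f,\varnothing)=i(\varnothing)$. It is given by $$f=i(\varnothing)+\sum_{\varnothing\neq S\subseteq N}\frac{v_{S,\mathbf{p}}}{v_{S,\mathbf{p}}(S)-v_{S,\mathbf{p}}(\varnothing)}\sum_{T\subseteq S}(-1)^{|S|-|T|}\,i(T).$$ There exists a unique set function $g\in\mathcal{F}^N$ such that $\Phi_{\mathrm{B},\mathbf{p}}(g,S)=i(S)$ for every nonempty $S\subseteq N$ and $g(\varnothing)=i(\varnothing)$. It is given by $$g=i(\varnothing)+\sum_{\varnothing\neq S\subseteq N}\frac{v_{S,\mathbf{p}}-v_{S,\mathbf{p}}(\varnothing)}{v_{S,\mathbf{p}}(S)-v_{S,\mathbf{p}}(\varnothing)}\sum_{T\subseteq S}(-1)^{|S|-|T|}\,i(T).$$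
   Context: Let $n\geqslant 1$, $N=\{1,\ldots,n\}$, and $\mathbf{p}=(p_1,\ldots,p_n)\in\,]0,1[^n$. Boolean vectors $\mathbf{x}\in\{0,1\}^n$ are identified with subsets $T\subseteq N$ via $x_i=1\iff i\in T$. $\mathcal{F}^N$ is the real vector space of all functions $f\colon\{0,1\}^n\to\mathbb{R}$ (equivalently set functions $f\colon 2^N\to\mathbb{R}$). For $T\subseteq N$ let $u_T(\mathbf{x})=\prod_{i\in T}x_i$ (with $u_\varnothing=1$). Let $w(S)=\prod_{i\in S}p_i\prod_{i\in N\setminus S}(1-p_i)$, $\langle f,g\rangle=\sum_{\mathbf{x}\in\{0,1\}^n}w(\mathbf{x})f(\mathbf{x})g(\mathbf{x})$, and $$v_{T,\mathbf{p}}(\mathbf{x})=\prod_{i\in T}\frac{x_i-p_i}{\sqrt{p_i(1-p_i)}},\qquad T\subseteq N.$$ For $S\subseteq N$ let $V_S$ be the linear span of $\{u_T:T\subseteq S\}$. The (weighted) best $S$-approximation of $f$ is the unique $f_{S,\mathbf{p}}\in V_S$ minimizing $\sum_{T\subseteq N}w(T)(f(T)-g(T))^2$ among all $g\in V_S$. The weighted Banzhaf influence index is $\Phi_{\mathrm{B},\mathbf{p}}(f,S)=f_{S,\mathbf{p}}(S)-f_{S,\mathbf{p}}(\varnothing)$. The weighted Banzhaf interaction index is $I_{\mathrm{B},\mathbf{p}}(f,S)=\langle f,v_{S,\mathbf{p}}\rangle/\prod_{i\in S}\sqrt{p_i(1-p_i)}$. The tuple $\mathbf{p}$ is nondegenerate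 if $v_{S,\mathbf{p}}(S)\neq v_{S,\mathbf{p}}(\varnothing)$ for every nonempty $S\subseteq N$.
   Formalization: In both displayed formulas the inner sum is taken over nonempty T ⊆ S instead of all T ⊆ S; the printed formulas fail when i(∅) ≠ 0 (for n = 1 they give Φ(f,{1}) = i({1}) − i(∅)), and agree with the corrected ones when i(∅) = 0. *)

theory Defs
  imports "HOL-Analysis.Analysis"
begin

text \<open>
  The ground set \<open>N\<close> is a finite type \<open>'n\<close>. A Boolean vector is identified with the subset
  of coordinates where it equals 1, so its \<open>i\<close>-th entry is \<open>of_bool (i \<in> X)\<close>, and
  the space of all real functions on Boolean vectors is the Euclidean space
  \<open>real ^ ('n set)\<close>, in which \<open>f $ X\<close> is the value of \<open>f\<close> at \<open>X\<close>.
\<close>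

definition u :: "'n set \<Rightarrow> real ^ ('n::finite set)" where
  "u T = (\<chi> X. \<Prod>i\<in>T. of_bool (i \<in> X))"

definition w :: "real ^ 'n \<Rightarrow> 'n::finite set \<Rightarrow> real" where
  "w p S = (\<Prod>i\<in>S. p $ i) * (\<Prod>i\<in>UNIV - S. 1 - p $ i)"

definition weighted_inner ::
  "real ^ 'n \<Rightarrow> real ^ ('n set) \<Rightarrow> real ^ ('n::finite set) \<Rightarrow> real" where
  "weighted_inner p f g = (\<Sum>X\<in>UNIV. w p X * f $ X * g $ X)"

definition v :: "real ^ 'n \<Rightarrow> 'n set \<Rightarrow> real ^ ('n::finite set)" where
  "v p T = (\<chi> X. \<Prod>i\<in>T. (of_bool (i \<in> X) - p $ i) / sqrt (p $ i * (1 - p $ i)))"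

definition V :: "'n set \<Rightarrow> (real ^ ('n::finite set)) set" where
  "V S = span {u T | T. T \<subseteq> S}"

definition weighted_sq_dist ::
  "real ^ 'n \<Rightarrow> real ^ ('n set) \<Rightarrow> real ^ ('n::finite set) \<Rightarrow> real" where
  "weighted_sq_dist p f g = (\<Sum>T\<in>UNIV. w p T * (f $ T - g $ T)\<^sup>2)"

text \<open>
  The minimizer exists and is unique, so that \<open>THE\<close> denotes it, as soon as all weights
  \<open>w p T\<close> are positive, i.e. when \<open>0 < p $ i < 1\<close> for all \<open>i\<close>.
\<close>

definition best_approx ::
  "real ^ 'n \<Rightarrow> real ^ ('n set) \<Rightarrow> 'n set \<Rightarrow> real ^ ('n::finite set)" where
  "best_approx p f S =
     (THE g. g \<in> V S \<and> (\<forall>h\<in>V S. weighted_sq_dist p f g \<le> weighted_sq_dist p f h))"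

definition banzhaf_influence ::
  "real ^ 'n \<Rightarrow> real ^ ('n set) \<Rightarrow> 'n::finite set \<Rightarrow> real" where
  "banzhaf_influence p f S = best_approx p f S $ S - best_approx p f S $ {}"

definition banzhaf_interaction ::
  "real ^ 'n \<Rightarrow> real ^ ('n set) \<Rightarrow> 'n::finite set \<Rightarrow> real" where
  "banzhaf_interaction p f S =
     weighted_inner p f (v p S) / (\<Prod>i\<in>S. sqrt (p $ i * (1 - p $ i)))"

definition nondegenerate :: "real ^ 'n::finite \<Rightarrow> bool" where
  "nondegenerate p \<longleftrightarrow> (\<forall>S. S \<noteq> {} \<longrightarrow> v p S $ S \<noteq> v p S $ {})"

end

theory Submission
  imports Defs
begin

text \<open>
  The functions \<^term>\<open>v p S\<close> form an orthonormal basis, and those with \<open>T \<subseteq> S\<close> span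
  \<^term>\<open>V S\<close>, so a best approximation merely truncates the expansion of \<open>f\<close> with coefficients
  \<open>c T = \<langle>f, v\<^sub>T\<rangle>\<close>. As \<open>v\<^sub>T(S) = v\<^sub>T(T)\<close> for \<open>T \<subseteq> S\<close>, the influence of \<open>S\<close> is
  \<open>\<Sum>T\<subseteq>S. c T * (v\<^sub>T(T) - v\<^sub>T(\<emptyset>))\<close>, and Moebius inversion recovers every \<open>c T\<close> with \<open>T \<noteq> \<emptyset>\<close>.
  The condition on the empty set fixes \<open>c \<emptyset>\<close>.
\<close>

section \<open>Moebius inversion over subsets\<close>

lemma moebius_inversion_iff:
  fixes a b :: "'a::finite set \<Rightarrow> real"
  shows "(\<forall>S. sum a (Pow S) = b S) \<longleftrightarrow>
    (\<forall>S. a S = (\<Sum>T\<in>Pow S. (-1) ^ (card S - card T) * b T))"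
proof
  assume "\<forall>S. sum a (Pow S) = b S"
  then show "\<forall>S. a S = (\<Sum>T\<in>Pow S. (-1) ^ (card S - card T) * b T)"
    by (intro allI inclusion_exclusion_mobius) auto
next
  assume a: "\<forall>S. a S = (\<Sum>T\<in>Pow S. (-1) ^ (card S - card T) * b T)"
  \<comment> \<open>Attaching the sign of \<open>card S\<close> to \<open>a S\<close> gives the
    self-inverse form of inclusion-exclusion, which can be read backwards.\<close>
  have alt: "(-1) ^ card S * a S = (\<Sum>T\<in>Pow S. (-1) ^ card T * b T)" for S
    unfolding a[rule_format, of S] sum_distrib_left
  proof (rule sum.cong[OF refl])
    fix T assume "T \<in> Pow S"
    then have "card T \<le> card S" by (simp add: card_mono)
    then have "(-1) ^ card S * (-1) ^ (card S - card T) = ((-1) ^ card T :: real)"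
      by (metis diff_diff_cancel diff_le_self neg_one_power_add_eq_neg_one_power_diff power_add)
    then show "(-1) ^ card S * ((-1) ^ (card S - card T) * b T) = (-1) ^ card T * b T"
      by (simp flip: mult.assoc)
  qed
  have "b S = (\<Sum>T\<in>Pow S. (-1) ^ card T * ((-1) ^ card T * a T))" for S
    by (rule inclusion_exclusion_symmetric[OF alt]) simp
  then show "\<forall>S. sum a (Pow S) = b S"
    by (simp flip: power_add mult.assoc)
qed

text \<open>Multiplying out the right-hand product amounts to choosing the set \<open>X\<close> of
  coordinates equal to 1. For parameters in the open unit interval this is the factorization of an
  expectation over independent Bernoulli variables.\<close>

lemma sum_w_prod:
  "(\<Sum>X\<in>UNIV. w p X * (\<Prod>j\<in>UNIV. h j (j \<in> X))) =
    (\<Prod>j\<in>UNIV. p $ j * h j True + (1 - p $ j) * h j False)"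
proof -
  have "(\<Prod>j\<in>UNIV. p $ j * h j True + (1 - p $ j) * h j False) =
    (\<Sum>X\<in>Pow UNIV. (\<Prod>j\<in>X. p $ j * h j True) * (\<Prod>j\<in>UNIV - X. (1 - p $ j) * h j False))"
    by (rule prod_add) simp
  also have "\<dots> = (\<Sum>X\<in>UNIV. w p X * (\<Prod>j\<in>UNIV. h j (j \<in> X)))"
  proof (rule sum.cong)
    fix X
    have "(\<Prod>j\<in>UNIV. h j (j \<in> X)) =
        (\<Prod>j\<in>UNIV - X. h j (j \<in> X)) * (\<Prod>j\<in>X. h j (j \<in> X))"
      by (rule prod.subset_diff) auto
    then show "(\<Prod>j\<in>X. p $ j * h j True) * (\<Prod>j\<in>UNIV - X. (1 - p $ j) * h j False)
        = w p X * (\<Prod>j\<in>UNIV. h j (j \<in> X))"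
      by (simp add: w_def prod.distrib)
  qed simp
  finally show ?thesis by simp
qed

section \<open>The weighted inner product and distance\<close>

lemma weighted_inner_sum_left:
  "weighted_inner p (\<Sum>k\<in>K. f k) g = (\<Sum>k\<in>K. weighted_inner p (f k) g)"
  unfolding weighted_inner_def sum_component sum_distrib_left sum_distrib_right
  by (rule sum.swap)

lemma weighted_inner_scaleR_left:
  "weighted_inner p (c *\<^sub>R f) g = c * weighted_inner p f g"
  by (simp add: weighted_inner_def sum_distrib_left algebra_simps)

lemma weighted_inner_diff_left:
  "weighted_inner p (f - g) h = weighted_inner p f h - weighted_inner p g h"
  by (simp add: weighted_inner_def sum_subtractf algebra_simps)

text \<open>Lets orthogonality to a span be checked on its generators.\<close>

lemma subspace_weighted_orthogonal: "subspace {h. weighted_inner p f h = 0}"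
  by (auto simp: subspace_def weighted_inner_def algebra_simps sum.distrib
      simp flip: sum_distrib_left)

lemma weighted_sq_dist_pythagoras:
  assumes "weighted_inner p (f - g) (g - h) = 0"
  shows "weighted_sq_dist p f h = weighted_sq_dist p f g + weighted_sq_dist p g h"
proof -
  have "weighted_sq_dist p f h = weighted_sq_dist p f g + weighted_sq_dist p g h
      + 2 * weighted_inner p (f - g) (g - h)"
    by (simp add: weighted_sq_dist_def weighted_inner_def sum_distrib_left power2_eq_square
        algebra_simps flip: sum.distrib sum_subtractf)
  with assms show ?thesis by simp
qed

section \<open>The products \<open>v p T\<close> and the spaces \<open>V S\<close>\<close>

lemma v_empty [simp]: "v p {} $ X = 1"
  by (simp add: v_def)

text \<open>The product reads only the coordinates in \<open>T\<close>, and these are 1 at both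
  points.\<close>

lemma v_subset: "T \<subseteq> S \<Longrightarrow> v p T $ S = v p T $ T"
  by (auto simp: v_def intro!: prod.cong)

lemma v_in_V:
  fixes p :: "real ^ 'n::finite"
  assumes "T \<subseteq> S"
  shows "v p T \<in> V S"
proof -
  define s where "s j = sqrt (p $ j * (1 - p $ j))" for j
  \<comment> \<open>When the affine factors are multiplied out, \<open>U\<close> is the set of
    coordinates that contribute their linear term.\<close>
  have "v p T = (\<Sum>U\<in>Pow T. ((\<Prod>j\<in>U. 1 / s j) * (\<Prod>j\<in>T - U. - p $ j / s j)) *\<^sub>R u U)"
  proof (subst vec_eq_iff, intro allI)
    fix X :: "'n set"
    have "v p T $ X = (\<Prod>j\<in>T. of_bool (j \<in> X) * (1 / s j) + - p $ j / s j)"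
      by (simp add: v_def s_def diff_divide_distrib)
    also have "\<dots> = (\<Sum>U\<in>Pow T. (\<Prod>j\<in>U. of_bool (j \<in> X) * (1 / s j)) * (\<Prod>j\<in>T - U. - p $ j / s j))"
      by (rule prod_add) simp
    also have "\<dots> = (\<Sum>U\<in>Pow T. ((\<Prod>j\<in>U. 1 / s j) * (\<Prod>j\<in>T - U. - p $ j / s j)) *\<^sub>R u U) $ X"
      unfolding sum_component
      by (intro sum.cong refl) (simp add: u_def prod.distrib prod_dividef)
    finally show "v p T $ X = \<dots>" .
  qed
  also have "\<dots> \<in> V S"
    unfolding V_def using assms by (intro span_sum span_scale span_base) auto
  finally show ?thesis .
qed

section \<open>Orthonormality and completeness for \<open>p\<close> in the open cube\<close>

context
  fixes p :: "real ^ 'n::finite"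
  assumes p01: "\<forall>j. 0 < p $ j \<and> p $ j < 1"
begin

lemma w_pos: "0 < w p X"
  using p01 by (auto simp: w_def intro!: mult_pos_pos prod_pos)

lemma weighted_sq_dist_nonneg: "0 \<le> weighted_sq_dist p f g"
  unfolding weighted_sq_dist_def
  by (intro sum_nonneg mult_nonneg_nonneg zero_le_power2 less_imp_le[OF w_pos])

text \<open>Every weight is strictly positive, so each squared difference vanishes. This gives
  uniqueness of the minimizer.\<close>

lemma weighted_sq_dist_le_0D:
  assumes "weighted_sq_dist p f g \<le> 0"
  shows "f = g"
proof -
  have nn: "0 \<le> w p T * (f $ T - g $ T)\<^sup>2" for T
    using w_pos[of T] by simp
  have "weighted_sq_dist p f g = 0"
    using assms weighted_sq_dist_nonneg by (rule antisym)
  then have "\<forall>T. w p T * (f $ T - g $ T)\<^sup>2 = 0"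
    unfolding weighted_sq_dist_def using nn by (subst (asm) sum_nonneg_eq_0_iff) auto
  then show ?thesis
    using w_pos by (simp add: vec_eq_iff less_imp_neq[symmetric])
qed

text \<open>The inner product factors over coordinates. An index in exactly one of \<open>S\<close>,
  \<open>T\<close> contributes the mean 0 of a standardized Bernoulli variable, an index in both its
  variance 1, and an index in neither the factor 1.\<close>

lemma v_orthonormal: "weighted_inner p (v p S) (v p T) = of_bool (S = T)"
proof -
  define z where "z j b = (of_bool b - p $ j) / sqrt (p $ j * (1 - p $ j))" for j and b
  define h where "h j b = (if j \<in> S then z j b else 1) * (if j \<in> T then z j b else 1)" for j b
  \<comment> \<open>Padding with factors 1 extends the products to all coordinates, as
    \<open>sum_w_prod\<close> requires.\<close>
  have v: "v p S $ X = (\<Prod>j\<in>UNIV. if j \<in> S then z j (j \<in> X) else 1)" for S X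
    by (simp add: v_def z_def prod.If_cases)
  have "weighted_inner p (v p S) (v p T) = (\<Sum>X\<in>UNIV. w p X * (\<Prod>j\<in>UNIV. h j (j \<in> X)))"
    by (simp add: weighted_inner_def v h_def prod.distrib mult.assoc)
  also have "\<dots> = (\<Prod>j\<in>UNIV. p $ j * h j True + (1 - p $ j) * h j False)"
    by (rule sum_w_prod)
  also have "\<dots> = (\<Prod>j\<in>UNIV. of_bool (j \<in> S \<longleftrightarrow> j \<in> T))"
  proof (rule prod.cong[OF refl])
    fix j
    have p: "0 < p $ j" "p $ j < 1" using p01 by auto
    then have zz: "z j b * z j b = (of_bool b - p $ j)\<^sup>2 / (p $ j * (1 - p $ j))" for b
      by (simp add: z_def power2_eq_square)
    have "p $ j * z j True + (1 - p $ j) * z j False = 0"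
      by (simp add: z_def)
    moreover have "p $ j * (z j True * z j True) + (1 - p $ j) * (z j False * z j False) = 1"
      using p unfolding zz by (simp add: power2_eq_square)
    ultimately show "p $ j * h j True + (1 - p $ j) * h j False = of_bool (j \<in> S \<longleftrightarrow> j \<in> T)"
      by (auto simp: h_def)
  qed
  also have "\<dots> = of_bool (S = T)"
    by auto
  finally show ?thesis .
qed

lemma weighted_inner_sum_v:
  "weighted_inner p (\<Sum>S\<in>A. c S *\<^sub>R v p S) (v p T) = (if T \<in> A then c T else 0)"
  by (simp add: weighted_inner_sum_left weighted_inner_scaleR_left v_orthonormal of_bool_def
      if_distrib[of "(*) _"] cong: if_cong)

text \<open>Completeness: a square matrix with orthonormal rows has orthonormal columns.\<close>

lemma v_expansion: "f = (\<Sum>S\<in>UNIV. weighted_inner p f (v p S) *\<^sub>R v p S)"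
proof -
  \<comment> \<open>With the weight in \<open>A\<close> alone, \<open>A ** B\<close> has the inner
    products as entries, \<open>A *v f\<close> lists the coefficients of \<open>f\<close>, and
    \<open>B\<close> reassembles \<open>f\<close> from them.\<close>
  define A :: "real ^ ('n set) ^ ('n set)" where "A = (\<chi> S X. w p X * v p S $ X)"
  define B :: "real ^ ('n set) ^ ('n set)" where "B = (\<chi> X S. v p S $ X)"
  have "A ** B = mat 1"
    using v_orthonormal
    by (auto simp: vec_eq_iff matrix_matrix_mult_def A_def B_def mat_def weighted_inner_def)
  then have "B ** A = mat 1"
    by (simp add: matrix_left_right_inverse)
  then have "f = B *v (A *v f)"
    by (simp add: matrix_vector_mul_assoc)
  also have "\<dots> = (\<Sum>S\<in>UNIV. weighted_inner p f (v p S) *\<^sub>R v p S)"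
    by (simp add: vec_eq_iff matrix_vector_mult_def A_def B_def weighted_inner_def mult_ac)
  finally show ?thesis .
qed

lemma eq_sum_v_iff:
  "f = (\<Sum>S\<in>UNIV. c S *\<^sub>R v p S) \<longleftrightarrow> (\<forall>S. weighted_inner p f (v p S) = c S)"
  using v_expansion[of f] weighted_inner_sum_v[of c UNIV] by auto

text \<open>Each coordinate is an affine function of its standardized version, so multiplying out
  over \<open>T\<close> yields only \<open>v p U\<close> with
  \<open>U \<subseteq> T\<close>.\<close>

lemma u_in_span_v:
  assumes "T \<subseteq> S"
  shows "u T \<in> span {v p U | U. U \<subseteq> S}"
proof -
  define s where "s = (\<lambda>j. sqrt (p $ j * (1 - p $ j)))"
  have s: "s j \<noteq> 0" for j
    using p01 by (simp add: s_def less_imp_neq[symmetric] less_imp_neq)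
  have "u T = (\<Sum>U\<in>Pow T. ((\<Prod>j\<in>U. s j) * (\<Prod>j\<in>T - U. p $ j)) *\<^sub>R v p U)"
  proof (subst vec_eq_iff, intro allI)
    fix X :: "'n set"
    have "u T $ X = (\<Prod>j\<in>T. s j * ((of_bool (j \<in> X) - p $ j) / s j) + p $ j)"
      using s by (simp add: u_def)
    also have "\<dots> = (\<Sum>U\<in>Pow T.
        (\<Prod>j\<in>U. s j * ((of_bool (j \<in> X) - p $ j) / s j)) * (\<Prod>j\<in>T - U. p $ j))"
      by (rule prod_add) simp
    also have "\<dots> = (\<Sum>U\<in>Pow T. ((\<Prod>j\<in>U. s j) * (\<Prod>j\<in>T - U. p $ j)) *\<^sub>R v p U) $ X"
      unfolding sum_component
      by (intro sum.cong refl) (simp only: v_def s_def prod.distrib vector_scaleR_component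
          real_scaleR_def vec_lambda_beta mult_ac)
    finally show "u T $ X = \<dots>" .
  qed
  also have "\<dots> \<in> span {v p U | U. U \<subseteq> S}"
    using assms by (intro span_sum span_scale span_base) auto
  finally show ?thesis .
qed

lemma V_eq_span_v: "V S = span {v p T | T. T \<subseteq> S}"
proof
  show "V S \<subseteq> span {v p T | T. T \<subseteq> S}"
    unfolding V_def by (rule span_minimal) (auto intro: u_in_span_v)
  show "span {v p T | T. T \<subseteq> S} \<subseteq> V S"
    by (rule span_minimal) (auto simp: v_in_V, simp add: V_def)
qed

section \<open>Best approximations and influence in terms of coefficients\<close>

lemma best_approx_eq:
  "best_approx p f S = (\<Sum>T\<in>Pow S. weighted_inner p f (v p T) *\<^sub>R v p T)"
proof -
  define g where "g = (\<Sum>T\<in>Pow S. weighted_inner p f (v p T) *\<^sub>R v p T)"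
  have gV: "g \<in> V S"
    unfolding g_def V_eq_span_v by (intro span_sum span_scale span_base) auto
  \<comment> \<open>\<open>f\<close> and \<open>g\<close> have equal coefficients at all
    \<open>T \<subseteq> S\<close>, so the residual is orthogonal to the generators of
    \<open>V S\<close>.\<close>
  have "weighted_inner p (f - g) h = 0" if "h \<in> V S" for h
  proof -
    have "V S \<subseteq> {h. weighted_inner p (f - g) h = 0}"
      unfolding V_eq_span_v
    proof (rule span_minimal[OF _ subspace_weighted_orthogonal])
      show "{v p T |T. T \<subseteq> S} \<subseteq> {h. weighted_inner p (f - g) h = 0}"
        by (auto simp: weighted_inner_diff_left g_def weighted_inner_sum_v)
    qed
    with that show ?thesis by auto
  qed
  \<comment> \<open>Since \<open>g - h\<close> lies in \<open>V S\<close>, the excess of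
    \<open>h\<close> over \<open>g\<close> is exactly their distance. Minimality and uniqueness both
    follow.\<close>
  then have pyth: "weighted_sq_dist p f h = weighted_sq_dist p f g + weighted_sq_dist p g h"
    if "h \<in> V S" for h
    using that gV
    by (intro weighted_sq_dist_pythagoras) (auto simp: V_def span_diff)
  show ?thesis
    unfolding best_approx_def g_def[symmetric]
  proof (rule the_equality)
    show "g \<in> V S \<and> (\<forall>h\<in>V S. weighted_sq_dist p f g \<le> weighted_sq_dist p f h)"
      using gV weighted_sq_dist_nonneg by (metis pyth le_add_same_cancel1)
  next
    fix h assume h: "h \<in> V S \<and> (\<forall>h'\<in>V S. weighted_sq_dist p f h \<le> weighted_sq_dist p f h')"
    then have "weighted_sq_dist p f h \<le> weighted_sq_dist p f g"
      using gV by blast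
    then have "weighted_sq_dist p g h \<le> 0"
      using pyth[of h] h by linarith
    then show "h = g"
      using weighted_sq_dist_le_0D by metis
  qed
qed

lemma banzhaf_influence_eq:
  "banzhaf_influence p f S =
    (\<Sum>T\<in>Pow S. weighted_inner p f (v p T) * (v p T $ T - v p T $ {}))"
proof -
  have "banzhaf_influence p f S =
      (\<Sum>T\<in>Pow S. weighted_inner p f (v p T) * (v p T $ S - v p T $ {}))"
    by (simp add: banzhaf_influence_def best_approx_eq right_diff_distrib sum_subtractf)
  \<comment> \<open>The summand no longer depends on \<open>S\<close>, as Moebius inversion
    demands.\<close>
  also have "\<dots> = (\<Sum>T\<in>Pow S. weighted_inner p f (v p T) * (v p T $ T - v p T $ {}))"
    by (intro sum.cong refl) (metis PowD v_subset)
  finally show ?thesis .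
qed

lemma banzhaf_influence_iff:
  assumes "nondegenerate p"
  shows "(\<forall>S. S \<noteq> {} \<longrightarrow> banzhaf_influence p f S = i $ S) \<longleftrightarrow>
    (\<forall>S. S \<noteq> {} \<longrightarrow> weighted_inner p f (v p S) =
      (\<Sum>T\<in>Pow S - {{}}. (-1) ^ (card S - card T) * i $ T) / (v p S $ S - v p S $ {}))"
proof -
  \<comment> \<open>The influence of the empty set is always 0, whatever \<open>i $ {}\<close> is.
    Hence the term \<open>T = {}\<close> drops out of the inverted sums.\<close>
  define b where "b S = (if S = {} then 0 else i $ S)" for S
  define a where "a S = weighted_inner p f (v p S) * (v p S $ S - v p S $ {})" for S
  have b: "(\<Sum>T\<in>Pow S. (-1) ^ (card S - card T) * b T) =
      (\<Sum>T\<in>Pow S - {{}}. (-1) ^ (card S - card T) * i $ T)" for S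
    by (intro sum.mono_neutral_cong_right) (auto simp: b_def)
  have "(\<forall>S. S \<noteq> {} \<longrightarrow> banzhaf_influence p f S = i $ S) \<longleftrightarrow> (\<forall>S. sum a (Pow S) = b S)"
    by (auto simp: banzhaf_influence_eq a_def b_def)
  also have "\<dots> \<longleftrightarrow> (\<forall>S. a S = (\<Sum>T\<in>Pow S - {{}}. (-1) ^ (card S - card T) * i $ T))"
    unfolding moebius_inversion_iff b ..
  also have "\<dots> \<longleftrightarrow> (\<forall>S. S \<noteq> {} \<longrightarrow> weighted_inner p f (v p S) =
      (\<Sum>T\<in>Pow S - {{}}. (-1) ^ (card S - card T) * i $ T) / (v p S $ S - v p S $ {}))"
  \<comment> \<open>At \<open>S = {}\<close> both sides of the equation for \<open>a\<close> are 0,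
    so the coefficient of \<open>v p {}\<close> stays free.\<close>
  proof (intro iff_allI)
    fix S
    show "a S = (\<Sum>T\<in>Pow S - {{}}. (-1) ^ (card S - card T) * i $ T) \<longleftrightarrow>
      (S \<noteq> {} \<longrightarrow> weighted_inner p f (v p S) =
        (\<Sum>T\<in>Pow S - {{}}. (-1) ^ (card S - card T) * i $ T) / (v p S $ S - v p S $ {}))"
      using assms by (cases "S = {}") (auto simp: a_def nondegenerate_def eq_divide_eq)
  qed
  finally show ?thesis .
qed

end

section \<open>Existence, uniqueness and explicit formulas\<close>

theorem proposition4p9:
  fixes p :: "real ^ 'n::finite" and i :: "real ^ ('n set)"
  assumes p01: "\<forall>j. 0 < p $ j \<and> p $ j < 1"
    and nondeg: "nondegenerate p"
  shows "((\<exists>!f. (\<forall>S. S \<noteq> {} \<longrightarrow> banzhaf_influence p f S = i $ S) \<and>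
                banzhaf_interaction p f {} = i $ {}) \<and>
          (\<forall>f. (\<forall>S. S \<noteq> {} \<longrightarrow> banzhaf_influence p f S = i $ S) \<and>
                banzhaf_interaction p f {} = i $ {} \<longrightarrow>
             f = (\<chi> X. i $ {} +
               (\<Sum>S\<in>UNIV - {{}}. v p S $ X / (v p S $ S - v p S $ {}) *
                 (\<Sum>T\<in>Pow S - {{}}. (-1) ^ (card S - card T) * i $ T))))) \<and>
         ((\<exists>!g. (\<forall>S. S \<noteq> {} \<longrightarrow> banzhaf_influence p g S = i $ S) \<and>
                g $ {} = i $ {}) \<and>
          (\<forall>g. (\<forall>S. S \<noteq> {} \<longrightarrow> banzhaf_influence p g S = i $ S) \<and>
                g $ {} = i $ {} \<longrightarrow>
             g = (\<chi> X. i $ {} +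
               (\<Sum>S\<in>UNIV - {{}}. (v p S $ X - v p S $ {}) / (v p S $ S - v p S $ {}) *
                 (\<Sum>T\<in>Pow S - {{}}. (-1) ^ (card S - card T) * i $ T)))))"
proof -
  define m where "m S = (\<Sum>T\<in>Pow S - {{}}. (-1) ^ (card S - card T) * i $ T)" for S
  define d where "d S = v p S $ S - v p S $ {}" for S
  \<comment> \<open>The influences fix all coefficients but the constant one, which is the parameter
    \<open>e\<close>.\<close>
  define k where "k e S = (if S = {} then e else m S / d S)" for e S
  define F where "F = (\<chi> X. i $ {} + (\<Sum>S\<in>UNIV - {{}}. v p S $ X / d S * m S))"
  define G where "G = (\<chi> X. i $ {} + (\<Sum>S\<in>UNIV - {{}}. (v p S $ X - v p S $ {}) / d S * m S))"
  \<comment> \<open>The constant coefficient of \<open>G\<close>, after collecting the subtracted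
    values \<open>v p S $ {}\<close>.\<close>
  define e where "e = i $ {} - (\<Sum>S\<in>UNIV - {{}}. v p S $ {} / d S * m S)"
  have sum_k: "(\<Sum>S\<in>UNIV. k x S *\<^sub>R v p S) $ X =
      x + (\<Sum>S\<in>UNIV - {{}}. v p S $ X / d S * m S)" for x X
    by (subst sum.remove[of _ "{}"]) (auto simp: k_def mult_ac)
  have infl: "(\<forall>S. S \<noteq> {} \<longrightarrow> banzhaf_influence p f S = i $ S) \<longleftrightarrow>
      f = (\<Sum>S\<in>UNIV. k (weighted_inner p f (v p {})) S *\<^sub>R v p S)" for f
    unfolding banzhaf_influence_iff[OF p01 nondeg] eq_sum_v_iff[OF p01]
    by (auto simp: k_def m_def d_def)
  have inner_k: "weighted_inner p (\<Sum>S\<in>UNIV. k x S *\<^sub>R v p S) (v p {}) = x" for x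
    by (simp add: weighted_inner_sum_v[OF p01] k_def)
  have F: "F = (\<Sum>S\<in>UNIV. k (i $ {}) S *\<^sub>R v p S)"
    unfolding vec_eq_iff sum_k by (simp add: F_def)
  have G: "G = (\<Sum>S\<in>UNIV. k e S *\<^sub>R v p S)"
    unfolding vec_eq_iff sum_k
    by (simp add: G_def e_def diff_divide_distrib left_diff_distrib sum_subtractf)
  \<comment> \<open>The interaction index at \<open>{}\<close> is the constant coefficient itself.
    An equivalence with \<open>f = F\<close> yields existence, uniqueness and the formula at
    once.\<close>
  have "(\<forall>S. S \<noteq> {} \<longrightarrow> banzhaf_influence p f S = i $ S) \<and>
      banzhaf_interaction p f {} = i $ {} \<longleftrightarrow> f = F" for f
    unfolding infl F using inner_k[of "i $ {}"] by (auto simp: banzhaf_interaction_def)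
  moreover have "(\<forall>S. S \<noteq> {} \<longrightarrow> banzhaf_influence p g S = i $ S) \<and> g $ {} = i $ {} \<longleftrightarrow> g = G" for g
  proof
    assume g: "(\<forall>S. S \<noteq> {} \<longrightarrow> banzhaf_influence p g S = i $ S) \<and> g $ {} = i $ {}"
    then have eq: "g = (\<Sum>S\<in>UNIV. k (weighted_inner p g (v p {})) S *\<^sub>R v p S)"
      unfolding infl by blast
    \<comment> \<open>Evaluating the expansion at \<open>{}\<close> and solving for the constant
      coefficient.\<close>
    have "weighted_inner p g (v p {}) = e"
      using arg_cong[OF eq, of "\<lambda>f. f $ {}"] g by (simp only: sum_k e_def)
    with eq show "g = G" by (simp only: G)
  next
    assume "g = G"
    then show "(\<forall>S. S \<noteq> {} \<longrightarrow> banzhaf_influence p g S = i $ S) \<and> g $ {} = i $ {}"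
      unfolding infl using inner_k[of e] by (simp add: G sum_k e_def del: sum_component)
  qed
  ultimately show ?thesis
    unfolding F_def G_def m_def d_def by simp
qed

end
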